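(* The square root process of $\{\mathcal V(t)\}_{t\ge0}$, i.e. the process of symmetric positive definite square roots $\mathcal V^{1/2}(t)$ of $\mathcal V(t)=Y(t)\otimes Y(t)$, is given for $t\ge0$ by $$\mathcal V^{1/2}(t)=\begin{cases}|Y(t)|^{-1}\,\mathcal V(t), & Y(t)\ne0,\\ 0, & Y(t)=0.\end{cases}$$
   Context: $(\Omega,\mathcal F,\{\mathcal F_t\}_{t\ge0},\mathbb P)$ is a filtered probability space. $H$ is a real separable Hilbert space with inner product $\langle\cdot,\cdot\rangle$ and norm $|\cdot|$; $L(H)$ is the space of bounded linear operators on $H$. "Positive definite" for a symmetric operator $T$ is used in the sense $\langle Tf,f\rangle\ge0$ for all $f\in H$. For $f,g\in H$ the tensor product is the operator $f\otimes g:=\langle f,\cdot\rangle g$, and $f^{\otimes2}:=f\otimes f$. $\{W(t)\}_{t\ge0}$ is an $H$-valued $\mathcal F_t$-Wiener process with covariance operator $Q_W$ (symmetric, positive definite, trace class). $\mathcal A$ is a densely defined operator on $H$ generating a $C_0$-semigroup $\{\mathcal U(t)\}_{t\ge0}$, $\eta\in L(H)$, $Y_0\in H$. $\{Y(t)\}_{t\ge0}$ is the mild solution of $dY(t)=\mathcal AY(t)\,dt+\eta\,dW(t)$, $Y(0)=Y_0$, i.e. $Y(t)=\mathcal U(t)Y_0+\int_0^t\mathcal U(t-s)\eta\,dW(s)$. The tensor Heston stochastic variance process is $\mathcal V(t):=Y(t)^{\otimes2}$, a symmetric positive definite operator. *)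

theory Defs
  imports "HOL-Probability.Probability"
begin

subsection \<open>Bounded operators on a real Hilbert space\<close>

text \<open>
  A real separable Hilbert space is a type of sort
  \<open>{real_inner, banach, second_countable_topology}\<close>; a metric space is separable iff it is
  second countable. \<open>L(H)\<close> is the type of bounded linear functions on it.
\<close>

definition symmetric_op :: "('h::real_inner \<Rightarrow>\<^sub>L 'h) \<Rightarrow> bool" where
  "symmetric_op T \<longleftrightarrow> (\<forall>f g. T f \<bullet> g = f \<bullet> T g)"

text \<open>``Positive definite'' is meant in the non-strict sense throughout.\<close>

definition pos_def_op :: "('h::real_inner \<Rightarrow>\<^sub>L 'h) \<Rightarrow> bool" where
  "pos_def_op T \<longleftrightarrow> (\<forall>f. T f \<bullet> f \<ge> 0)"

text \<open>Trace class operators, as nuclear operators on a Hilbert space.\<close>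

definition trace_class_op :: "('h::real_inner \<Rightarrow>\<^sub>L 'h) \<Rightarrow> bool" where
  "trace_class_op T \<longleftrightarrow>
    (\<exists>(a :: nat \<Rightarrow> 'h) (b :: nat \<Rightarrow> 'h). summable (\<lambda>k. norm (a k) * norm (b k)) \<and>
       (\<forall>x. (\<lambda>k. (a k \<bullet> x) *\<^sub>R b k) sums T x))"

lift_definition tensor :: "'h::real_inner \<Rightarrow> 'h \<Rightarrow> ('h \<Rightarrow>\<^sub>L 'h)" is
  "\<lambda>f g x. (f \<bullet> x) *\<^sub>R g"
  by (intro bounded_linear_scaleR_const bounded_linear_inner_right)

definition is_pos_sqrt :: "('h::real_inner \<Rightarrow>\<^sub>L 'h) \<Rightarrow> ('h \<Rightarrow>\<^sub>L 'h) \<Rightarrow> bool" where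
  "is_pos_sqrt S T \<longleftrightarrow> symmetric_op S \<and> pos_def_op S \<and> S o\<^sub>L S = T"

text \<open>
  Meaningful only for operators with exactly one symmetric positive definite square root; on a
  Hilbert space these are the symmetric positive definite ones.
\<close>

definition op_sqrt :: "('h::real_inner \<Rightarrow>\<^sub>L 'h) \<Rightarrow> ('h \<Rightarrow>\<^sub>L 'h)" where
  "op_sqrt T = (THE S. is_pos_sqrt S T)"

definition is_orthonormal_basis :: "('h::real_inner) set \<Rightarrow> bool" where
  "is_orthonormal_basis B \<longleftrightarrow>
    pairwise orthogonal B \<and> (\<forall>e\<in>B. norm e = 1) \<and> closure (span B) = UNIV"

text \<open>The squared Hilbert-Schmidt norm; its value does not depend on the chosen basis.\<close>

definition hs_norm_sq :: "('h::real_inner \<Rightarrow>\<^sub>L 'h) \<Rightarrow> ennreal" where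
  "hs_norm_sq T = (\<Sum>\<^sub>\<infinity>e\<in>(SOME B. is_orthonormal_basis B). ennreal ((norm (T e))\<^sup>2))"

subsection \<open>Strongly continuous semigroups\<close>

definition C0_semigroup :: "(real \<Rightarrow> ('h::real_normed_vector \<Rightarrow>\<^sub>L 'h)) \<Rightarrow> bool" where
  "C0_semigroup U \<longleftrightarrow> U 0 = id_blinfun \<and>
    (\<forall>s\<ge>0. \<forall>t\<ge>0. U (s + t) = U s o\<^sub>L U t) \<and>
    (\<forall>x. ((\<lambda>t. U t x) \<longlongrightarrow> x) (at_right 0))"

text \<open>
  An unbounded operator is a domain \<open>D\<close> together with a function \<open>A\<close> whose values outside \<open>D\<close>
  are irrelevant.
\<close>

definition densely_defined_op :: "'h::real_normed_vector set \<Rightarrow> ('h \<Rightarrow> 'h) \<Rightarrow> bool" where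
  "densely_defined_op D A \<longleftrightarrow> subspace D \<and> closure D = UNIV \<and>
    (\<forall>x\<in>D. \<forall>y\<in>D. A (x + y) = A x + A y) \<and> (\<forall>c. \<forall>x\<in>D. A (c *\<^sub>R x) = c *\<^sub>R A x)"

definition generates ::
    "'h::real_normed_vector set \<Rightarrow> ('h \<Rightarrow> 'h) \<Rightarrow> (real \<Rightarrow> ('h \<Rightarrow>\<^sub>L 'h)) \<Rightarrow> bool" where
  "generates D A U \<longleftrightarrow>
    D = {x. \<exists>y. ((\<lambda>t. (U t x - x) /\<^sub>R t) \<longlongrightarrow> y) (at_right 0)} \<and>
    (\<forall>x\<in>D. ((\<lambda>t. (U t x - x) /\<^sub>R t) \<longlongrightarrow> A x) (at_right 0))"

subsection \<open>Wiener processes\<close>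

definition filtered_prob_space :: "'a measure \<Rightarrow> (real \<Rightarrow> 'a measure) \<Rightarrow> bool" where
  "filtered_prob_space M F \<longleftrightarrow> prob_space M \<and> (\<forall>t\<ge>0. subalgebra M (F t)) \<and>
    (\<forall>s t. 0 \<le> s \<longrightarrow> s \<le> t \<longrightarrow> sets (F s) \<subseteq> sets (F t))"

text \<open>The normal law with mean \<open>a\<close> and variance \<open>v\<close>, a point mass if \<open>v = 0\<close>.\<close>

definition normal_law :: "real \<Rightarrow> real \<Rightarrow> real measure" where
  "normal_law a v =
    (if v = 0 then return borel a
     else density lborel (\<lambda>x. ennreal (normal_density a (sqrt v) x)))"

definition gaussian_measure ::
    "'h::{real_inner, banach, second_countable_topology} measure \<Rightarrow> 'h \<Rightarrow> ('h \<Rightarrow>\<^sub>L 'h) \<Rightarrow> bool" where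
  "gaussian_measure \<mu> m Q \<longleftrightarrow> sets \<mu> = sets borel \<and>
    (\<forall>h. \<exists>a. \<exists>v\<ge>0. distr \<mu> borel (\<lambda>x. x \<bullet> h) = normal_law a v) \<and>
    (\<forall>h. (LINT x|\<mu>. x \<bullet> h) = m \<bullet> h) \<and>
    (\<forall>g h. (LINT x|\<mu>. ((x - m) \<bullet> g) * ((x - m) \<bullet> h)) = Q g \<bullet> h)"

definition wiener_process ::
    "'a measure \<Rightarrow> (real \<Rightarrow> 'a measure) \<Rightarrow>
     (real \<Rightarrow> 'a \<Rightarrow> 'h::{real_inner, banach, second_countable_topology}) \<Rightarrow> ('h \<Rightarrow>\<^sub>L 'h) \<Rightarrow> bool" where
  "wiener_process M F W Q \<longleftrightarrow>
    (AE \<omega> in M. W 0 \<omega> = 0) \<and>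
    (AE \<omega> in M. continuous_on {0..} (\<lambda>t. W t \<omega>)) \<and>
    (\<forall>t\<ge>0. W t \<in> borel_measurable (F t)) \<and>
    (\<forall>s t. 0 \<le> s \<longrightarrow> s \<le> t \<longrightarrow>
       prob_space.indep_set M (sets (F s))
         {(\<lambda>\<omega>. W t \<omega> - W s \<omega>) -` B \<inter> space M | B. B \<in> sets borel} \<and>
       gaussian_measure (distr M borel (\<lambda>\<omega>. W t \<omega> - W s \<omega>)) 0 ((t - s) *\<^sub>R Q))"

subsection \<open>The stochastic integral of a deterministic integrand\<close>

definition is_partition :: "real \<Rightarrow> nat \<Rightarrow> (nat \<Rightarrow> real) \<Rightarrow> bool" where
  "is_partition t n \<tau> \<longleftrightarrow> \<tau> 0 = 0 \<and> \<tau> n = t \<and> (\<forall>i<n. \<tau> i \<le> \<tau> (Suc i))"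

definition step_fun ::
    "nat \<Rightarrow> (nat \<Rightarrow> real) \<Rightarrow> (nat \<Rightarrow> ('h::real_normed_vector \<Rightarrow>\<^sub>L 'h)) \<Rightarrow> real \<Rightarrow> ('h \<Rightarrow>\<^sub>L 'h)" where
  "step_fun n \<tau> \<Psi> r = (\<Sum>i<n. indicator {\<tau> i<..\<tau> (Suc i)} r *\<^sub>R \<Psi> i)"

definition step_integral ::
    "(real \<Rightarrow> 'a \<Rightarrow> 'h::real_normed_vector) \<Rightarrow> nat \<Rightarrow> (nat \<Rightarrow> real) \<Rightarrow> (nat \<Rightarrow> ('h \<Rightarrow>\<^sub>L 'h)) \<Rightarrow> 'a \<Rightarrow> 'h"
  where
  "step_integral W n \<tau> \<Psi> \<omega> = (\<Sum>i<n. \<Psi> i (W (\<tau> (Suc i)) \<omega> - W (\<tau> i) \<omega>))"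

text \<open>
  \<open>X\<close> is a version of \<open>\<integral>\<^sub>0\<^sup>t \<Phi>(s) dW(s)\<close>: the \<open>L\<^sup>2\<close>-limit of the integrals of step
  functions that converge to \<open>\<Phi>\<close> in the norm of the Ito isometry,
  \<open>E|\<integral>\<^sub>0\<^sup>t \<Phi>(s) dW(s)|\<^sup>2 = \<integral>\<^sub>0\<^sup>t \<parallel>\<Phi>(s) Q\<^sup>1\<^sup>/\<^sup>2\<parallel>\<^sub>H\<^sub>S\<^sup>2 ds\<close>. It is unique up to null sets.
\<close>

definition is_stoch_integral ::
    "'a measure \<Rightarrow> (real \<Rightarrow> 'a \<Rightarrow> 'h::{real_inner, banach, second_countable_topology}) \<Rightarrow>
     ('h \<Rightarrow>\<^sub>L 'h) \<Rightarrow> real \<Rightarrow> (real \<Rightarrow> ('h \<Rightarrow>\<^sub>L 'h)) \<Rightarrow> ('a \<Rightarrow> 'h) \<Rightarrow> bool" where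
  "is_stoch_integral M W Q t \<Phi> X \<longleftrightarrow> X \<in> borel_measurable M \<and>
    (\<exists>(n :: nat \<Rightarrow> nat) \<tau> \<Psi>. (\<forall>k. is_partition t (n k) (\<tau> k)) \<and>
      ((\<lambda>k. \<integral>\<^sup>+r\<in>{0..t}. hs_norm_sq ((\<Phi> r - step_fun (n k) (\<tau> k) (\<Psi> k) r) o\<^sub>L op_sqrt Q) \<partial>lborel)
         \<longlonglongrightarrow> 0) \<and>
      ((\<lambda>k. \<integral>\<^sup>+\<omega>. ennreal ((norm (X \<omega> - step_integral W (n k) (\<tau> k) (\<Psi> k) \<omega>))\<^sup>2) \<partial>M)
         \<longlonglongrightarrow> 0))"

subsection \<open>The tensor Heston variance process\<close>

text \<open>
  The generator of \<open>U\<close> enters \<open>dY(t) = A Y(t) dt + \<eta> dW(t)\<close>, but its mild solution is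
  expressed through \<open>U\<close> alone.
\<close>

definition mild_solution ::
    "'a measure \<Rightarrow> (real \<Rightarrow> 'a \<Rightarrow> 'h::{real_inner, banach, second_countable_topology}) \<Rightarrow>
     ('h \<Rightarrow>\<^sub>L 'h) \<Rightarrow> (real \<Rightarrow> ('h \<Rightarrow>\<^sub>L 'h)) \<Rightarrow> ('h \<Rightarrow>\<^sub>L 'h) \<Rightarrow> 'h \<Rightarrow> (real \<Rightarrow> 'a \<Rightarrow> 'h) \<Rightarrow> bool" where
  "mild_solution M W Q U \<eta> Y\<^sub>0 Y \<longleftrightarrow>
    (\<forall>t\<ge>0. Y t \<in> borel_measurable M \<and>
      (\<exists>X. is_stoch_integral M W Q t (\<lambda>s. U (t - s) o\<^sub>L \<eta>) X \<and>
        (AE \<omega> in M. Y t \<omega> = U t Y\<^sub>0 + X \<omega>)))"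

definition variance_process ::
    "(real \<Rightarrow> 'a \<Rightarrow> 'h::real_inner) \<Rightarrow> real \<Rightarrow> 'a \<Rightarrow> ('h \<Rightarrow>\<^sub>L 'h)" where
  "variance_process Y t \<omega> = tensor (Y t \<omega>) (Y t \<omega>)"

end

theory Submission
  imports Defs
begin

text \<open>
  A symmetric positive square root \<open>S\<close> of \<open>y \<otimes> y\<close> satisfies \<open>|S x|\<^sup>2 = \<langle>y, x\<rangle>\<^sup>2\<close>, so it kills the
  orthogonal complement of \<open>y\<close>. By symmetry \<open>S y\<close> is then a multiple \<open>c y\<close>, and \<open>|S y| = |y|\<^sup>2\<close> with
  \<open>c \<ge> 0\<close> forces \<open>c = |y|\<close>.
\<close>

lemma tensor_apply: "tensor f g x = (f \<bullet> x) *\<^sub>R g"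
  by (simp add: tensor.rep_eq)

text \<open>The case \<open>y = 0\<close> is included because \<open>inverse 0 = 0\<close>.\<close>

lemma is_pos_sqrt_tensor:
  "is_pos_sqrt (inverse (norm y) *\<^sub>R tensor y y) (tensor y y)"
  unfolding is_pos_sqrt_def symmetric_op_def pos_def_op_def
proof (intro conjI allI)
  fix f g
  show "(inverse (norm y) *\<^sub>R tensor y y) f \<bullet> g = f \<bullet> (inverse (norm y) *\<^sub>R tensor y y) g"
    by (simp add: tensor_apply blinfun.scaleR_left inner_commute)
  show "0 \<le> (inverse (norm y) *\<^sub>R tensor y y) f \<bullet> f"
    by (simp add: tensor_apply blinfun.scaleR_left mult.assoc)
  \<comment> \<open>Composing produces the extra factor \<open>inverse (norm y)\<close> squared
    times \<open>y \<bullet> y\<close>, which cancels to 1 only for nonzero \<open>y\<close>; for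
    \<open>y = 0\<close> both sides vanish.\<close>
  show "(inverse (norm y) *\<^sub>R tensor y y) o\<^sub>L (inverse (norm y) *\<^sub>R tensor y y) = tensor y y"
    by (rule blinfun_eqI)
       (cases "y = 0"; simp add: tensor_apply blinfun.scaleR_left power2_norm_eq_inner[symmetric]
          power2_eq_square field_simps)
qed

text \<open>Symmetry moves one factor \<open>S\<close> across the inner product. Hence
  \<open>S\<close> vanishes wherever the quadratic form of \<open>T\<close> does.\<close>

lemma pos_sqrt_norm_sq:
  assumes "is_pos_sqrt S T"
  shows "(norm (S x))\<^sup>2 = T x \<bullet> x"
proof -
  have "(norm (S x))\<^sup>2 = S (S x) \<bullet> x"
    using assms by (simp add: is_pos_sqrt_def symmetric_op_def power2_norm_eq_inner)
  moreover have "S (S x) = T x"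
    using assms by (auto simp: is_pos_sqrt_def)
  ultimately show ?thesis by simp
qed

lemma pos_sqrt_tensor_unique:
  assumes S: "is_pos_sqrt S (tensor y y)"
  shows "S = inverse (norm y) *\<^sub>R tensor y y"
proof (rule blinfun_eqI)
  fix x
  have sym: "S f \<bullet> g = f \<bullet> S g" for f g
    using S by (simp add: is_pos_sqrt_def symmetric_op_def)
  have kernel: "S z = 0" if "y \<bullet> z = 0" for z
    using pos_sqrt_norm_sq[OF S, of z] that by (simp add: tensor_apply)
  show "S x = (inverse (norm y) *\<^sub>R tensor y y) x"
  proof (cases "y = 0")
    case True
    \<comment> \<open>Every vector is orthogonal to 0, so \<open>kernel\<close> applies to all of
      the space.\<close>
    then show ?thesis
      using kernel[of x] by (simp add: tensor_apply blinfun.scaleR_left)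
  next
    case False
    then have yy: "y \<bullet> y \<noteq> 0" by simp
    \<comment> \<open>\<open>c *\<^sub>R y\<close> is the orthogonal projection of
      \<open>S y\<close> onto the line of \<open>y\<close>. The remainder \<open>w\<close> is zero
      because \<open>S y \<bullet> w = y \<bullet> S w\<close> and \<open>S w = 0\<close>.\<close>
    define c where "c = (S y \<bullet> y) / (y \<bullet> y)"
    define w where "w = S y - c *\<^sub>R y"
    have yw: "y \<bullet> w = 0"
      using yy by (simp add: w_def c_def inner_diff_right inner_commute)
    have "w \<bullet> w = S y \<bullet> w - c * (y \<bullet> w)"
      unfolding w_def by (simp add: inner_diff_left)
    also have "\<dots> = 0"
      using sym[of y w] kernel[OF yw] yw by simp
    finally have Sy: "S y = c *\<^sub>R y"
      by (simp add: w_def)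
    have "c \<ge> 0"
      using S by (simp add: c_def is_pos_sqrt_def pos_def_op_def)
    moreover have "(c * norm y)\<^sup>2 = (norm (S y))\<^sup>2"
      by (simp add: Sy power_mult_distrib)
    moreover have "(norm (S y))\<^sup>2 = ((norm y)\<^sup>2)\<^sup>2"
      unfolding pos_sqrt_norm_sq[OF S]
      by (simp add: tensor_apply power2_norm_eq_inner power2_eq_square[of "y \<bullet> y"])
    \<comment> \<open>Positivity of \<open>S\<close> enters here: \<open>c \<ge> 0\<close> rules out
      the negative root \<open>c = - norm y\<close>.\<close>
    ultimately have "c * norm y = (norm y)\<^sup>2"
      by (metis mult_nonneg_nonneg norm_ge_zero power2_eq_imp_eq zero_le_power2)
    then have c: "c = norm y"
      using False by (simp add: power2_eq_square)
    \<comment> \<open>Subtracting from \<open>x\<close> its projection \<open>a *\<^sub>R y\<close>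
      leaves a vector in the kernel, so \<open>S x = a *\<^sub>R S y\<close>.\<close>
    define a where "a = (y \<bullet> x) / (y \<bullet> y)"
    have "S (x - a *\<^sub>R y) = 0"
      using yy by (intro kernel) (simp add: a_def inner_diff_right)
    then have "S x = (a * norm y) *\<^sub>R y"
      by (simp add: blinfun.diff_right blinfun.scaleR_right Sy c)
    also have "a * norm y = inverse (norm y) * (y \<bullet> x)"
      using False by (simp add: a_def power2_norm_eq_inner[symmetric] power2_eq_square field_simps)
    finally show ?thesis
      by (simp add: tensor_apply blinfun.scaleR_left)
  qed
qed

lemma op_sqrt_tensor: "op_sqrt (tensor y y) = inverse (norm y) *\<^sub>R tensor y y"
  unfolding op_sqrt_def
  by (rule the_equality) (auto intro: is_pos_sqrt_tensor pos_sqrt_tensor_unique)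

theorem proposition4:
  fixes M :: "'a measure"
    and F :: "real \<Rightarrow> 'a measure"
    and W Y :: "real \<Rightarrow> 'a \<Rightarrow> 'h::{real_inner, banach, second_countable_topology}"
    and Q \<eta> :: "'h \<Rightarrow>\<^sub>L 'h"
    and D :: "'h set" and A :: "'h \<Rightarrow> 'h"
    and U :: "real \<Rightarrow> ('h \<Rightarrow>\<^sub>L 'h)"
    and Y\<^sub>0 :: 'h
  assumes "filtered_prob_space M F"
    and "symmetric_op Q" and "pos_def_op Q" and "trace_class_op Q"
    and "wiener_process M F W Q"
    and "densely_defined_op D A"
    and "C0_semigroup U"
    and "generates D A U"
    and "mild_solution M W Q U \<eta> Y\<^sub>0 Y"
  shows "\<forall>t\<ge>0. \<forall>\<omega>\<in>space M.
    (\<exists>!S. is_pos_sqrt S (variance_process Y t \<omega>)) \<and>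
    op_sqrt (variance_process Y t \<omega>) =
      (if Y t \<omega> \<noteq> 0 then inverse (norm (Y t \<omega>)) *\<^sub>R variance_process Y t \<omega> else 0)"
proof (intro allI ballI impI conjI)
  fix t \<omega>
  show "\<exists>!S. is_pos_sqrt S (variance_process Y t \<omega>)"
    unfolding variance_process_def
    by (rule ex1I, rule is_pos_sqrt_tensor, rule pos_sqrt_tensor_unique)
  \<comment> \<open>Where \<open>Y t \<omega> = 0\<close>, the convention
    \<open>inverse 0 = 0\<close> turns the general formula into the second branch.\<close>
  show "op_sqrt (variance_process Y t \<omega>) =
      (if Y t \<omega> \<noteq> 0 then inverse (norm (Y t \<omega>)) *\<^sub>R variance_process Y t \<omega> else 0)"
    by (simp add: variance_process_def op_sqrt_tensor)
qed

end
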